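(* Let $n\ge 1$ be an integer and let $x_0,x_1,\ldots,x_{n-1}$ be real numbers. Then $$x_0x_1\cdots x_{n-1}=\sum_{S}\Bigl(\{X^{s_1:s_2}\}\,\{X^{s_2:s_3}\}\cdots\{X^{s_k:(s_1+n)}\}-(-1)^k\lfloor X^{s_1:s_2}\rfloor\,\lfloor X^{s_2:s_3}\rfloor\cdots\lfloor X^{s_k:(s_1+n)}\rfloor\Bigr),$$ where the sum is over all nonempty subsets $S=\{s_1,\ldots,s_k\}$ of $\{0,1,\ldots,n-1\}$, with elements listed so that $s_1<\cdots<s_k$ (here $k=|S|$ depends on $S$; when $k=1$ each of the two products consists of the single factor involving $X^{s_1:(s_1+n)}$).
   Context: For real $x$, $\lfloor x\rfloor$ is the greatest integer less than or equal to $x$, and $\{x\}=x-\lfloor x\rfloor$ is the fractional part. Given the sequence $X=(x_0,x_1,\ldots,x_{n-1})$, indices are read modulo $n$, i.e. $x_{n+j}=x_j$. For integers $0\le a\leq b$ define recursively $$X^{a:b}=\begin{cases}1, & a=b,\\ x_a\lfloor X^{(a+1):b}\rfloor, & a<b.\end{cases}$$ For example $X^{1:4}=x_1\bigl\lfloor x_2\lfloor x_3\rfloor\bigr\rfloor$. *)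

theory Defs
  imports Complex_Main
begin

text \<open>\<open>nested_floor n x a b\<close> is $X^{a:b}$ for the sequence $X = (x_0,\ldots,x_{n-1})$ with indices
  read modulo $n$. Only \<open>x 0, \<dots>, x (n - 1)\<close> are used. The value for \<open>a > b\<close>, where $X^{a:b}$ is not
  defined, is an arbitrary convention (and is never used below).\<close>

function nested_floor :: "nat \<Rightarrow> (nat \<Rightarrow> real) \<Rightarrow> nat \<Rightarrow> nat \<Rightarrow> real" where
  "nested_floor n x a b =
     (if a < b then x (a mod n) * real_of_int \<lfloor>nested_floor n x (Suc a) b\<rfloor> else 1)"
  by pat_completeness auto
termination by (relation "measure (\<lambda>(n, x, a, b). b - a)") auto

declare nested_floor.simps [simp del]

text \<open>For $S = \{s_1 < \cdots < s_k\}$ nonempty, the list $[s_1, \ldots, s_k, s_1 + n]$.\<close>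

definition cyclic_list :: "nat \<Rightarrow> nat set \<Rightarrow> nat list" where
  "cyclic_list n S = sorted_list_of_set S @ [Min S + n]"

end

theory Submission
  imports Defs
begin

text \<open>
  Write \<open>G a b\<close> for the floor of $X^{a:b}$, so that \<open>G a a = 1\<close> and, for \<open>a < b\<close>, the fractional
  part of $X^{a:b}$ is $x_a G(a+1,b) - G(a,b)$. In this form the identity is purely algebraic: it holds
  for every weight \<open>G\<close> that is invariant under the shift by \<open>n\<close> and has \<open>G a a = 1\<close>
  (lemma \<open>cyclic_product_expansion\<close>).

  A nonempty set \<open>S\<close> cuts the circle of length \<open>n\<close> into arcs. Expanding the product of the
  differences over the arcs selects a set \<open>U \<subseteq> S\<close> of arcs: an arc starting at \<open>s \<in> U\<close> contributes
  a unit step $x_s$ followed by an arc of weight $G(s+1,\cdot)$ (which is trivial if the arc had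
  length 1), any other arc contributes \<open>- G\<close>. The outcome is a tiling of the circle by unit steps,
  starting at \<open>U\<close>, and \<open>G\<close>-arcs, starting at the other points of \<open>V = S \<union> (U + 1)\<close>, taken modulo \<open>n\<close>
  (lemma \<open>arc_weights_refine\<close>). The terms with \<open>U = {}\<close> are the products of floors that the
  statement subtracts. If \<open>U\<close> is neither empty nor the whole circle, some \<open>w \<in> U + 1\<close> lies outside
  \<open>U\<close>; adding \<open>w\<close> to \<open>S\<close> or removing it does not change the tiling but changes the sign, so these
  terms cancel in pairs (lemma \<open>tilings_with_steps_cancel\<close>). What remains is the tiling by unit
  steps only, that is, the product of all the $x_i$.
\<close>

section \<open>Cyclic successors\<close>

text \<open>The subset of the circle is lifted to its \<open>n\<close>-periodic preimage in the naturals, so that the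
  arc from the largest element of \<open>S\<close> back to the smallest needs no separate treatment.\<close>

definition next_cut :: "nat \<Rightarrow> nat set \<Rightarrow> nat \<Rightarrow> nat" where
  "next_cut n S s = (LEAST t. s < t \<and> t mod n \<in> S)"

lemma next_cut_le: "s < t \<Longrightarrow> t mod n \<in> S \<Longrightarrow> next_cut n S s \<le> t"
  unfolding next_cut_def by (rule Least_le) simp

lemma next_cut_props:
  assumes "S \<subseteq> {0..<n}" "S \<noteq> {}"
  shows "s < next_cut n S s" "next_cut n S s mod n \<in> S"
proof -
  obtain e where e: "e \<in> S" "e < n" using assms by force
  have "s < n * Suc s + e" using e by (cases n) auto
  moreover have "(n * Suc s + e) mod n \<in> S" using e by (simp del: mult_Suc_right)
  ultimately have "s < next_cut n S s \<and> next_cut n S s mod n \<in> S"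
    unfolding next_cut_def by (intro LeastI) blast
  then show "s < next_cut n S s" "next_cut n S s mod n \<in> S" by auto
qed

lemma next_cut_eqI:
  assumes "s < t" "t mod n \<in> S" "\<And>t'. s < t' \<Longrightarrow> t' mod n \<in> S \<Longrightarrow> t \<le> t'"
  shows "next_cut n S s = t"
  unfolding next_cut_def by (rule Least_equality) (use assms in auto)

lemma next_cut_shift:
  assumes "S \<subseteq> {0..<n}" "S \<noteq> {}"
  shows "next_cut n S (s + n) = next_cut n S s + n"
proof (rule next_cut_eqI)
  show "s + n < next_cut n S s + n" "(next_cut n S s + n) mod n \<in> S"
    using next_cut_props[OF assms] by auto
next
  fix t assume t: "s + n < t" "t mod n \<in> S"
  then have "next_cut n S s \<le> t - n"
    by (intro next_cut_le) (auto simp: le_mod_geq)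
  with t show "next_cut n S s + n \<le> t" by simp
qed

lemma Suc_mod_cancel:
  "Suc t mod n = Suc u mod n \<Longrightarrow> u < n \<Longrightarrow> t mod n = u"
  by (auto simp: mod_Suc split: if_splits)

lemma Suc_mod_closed_imp_full:
  assumes "U \<subseteq> {0..<n}" "U \<noteq> {}" "\<And>u. u \<in> U \<Longrightarrow> Suc u mod n \<in> U"
  shows "U = {0..<n}"
proof -
  obtain u where u: "u \<in> U" "u < n" using assms by force
  have step: "(u + k) mod n \<in> U" for k
  proof (induction k)
    case (Suc k)
    from assms(3)[OF Suc] show ?case by (simp add: mod_Suc_eq)
  qed (use u in simp)
  have "v \<in> U" if "v < n" for v
    using step[of "v + n - u"] that u by simp
  with assms(1) show ?thesis by auto
qed

section \<open>Cancellation of tilings\<close>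

text \<open>Splitting off unit steps at \<open>U\<close> only adds the cut points \<open>U + 1\<close>. An arc that starts at
  \<open>s \<in> U\<close> either had length 1, and then its remainder has weight \<open>G a a = 1\<close>, or its remainder is
  the arc of the refined cutting that starts at the new point \<open>s + 1\<close>. All other arcs survive,
  because a new cut point lies immediately after an old one in \<open>U\<close>.\<close>

lemma arc_weights_refine:
  fixes G :: "nat \<Rightarrow> nat \<Rightarrow> real"
  assumes S: "S \<subseteq> {0..<n}" "U \<subseteq> S" "U \<noteq> {}"
    and G1: "\<And>a. G a a = 1" and Gn: "\<And>a b. G (a + n) (b + n) = G a b"
  defines "V \<equiv> S \<union> (\<lambda>u. Suc u mod n) ` U"
  shows "(\<Prod>s\<in>U. G (Suc s) (next_cut n S s)) * (\<Prod>s\<in>S - U. G s (next_cut n S s))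
       = (\<Prod>v\<in>V - U. G v (next_cut n V v))"
proof -
  have [simp]: "finite S" using S finite_subset by blast
  have [simp]: "finite U" using S finite_subset[of U S] by simp
  have Sne: "S \<noteq> {}" using S by auto
  have Vn: "V \<subseteq> {0..<n}" using S Sne unfolding V_def by force
  have Vne: "V \<noteq> {}" using Sne unfolding V_def by auto
  note nS = next_cut_props[OF S(1) Sne]
  have pred_cut: "next_cut n S s \<le> t"
    if t: "s < t" "t mod n \<in> V" and ne: "t mod n \<notin> S \<Longrightarrow> t \<noteq> Suc s" for s t
  proof (cases "t mod n \<in> S")
    case True
    then show ?thesis using t next_cut_le by blast
  next
    case False
    then obtain u where u: "u \<in> U" "t mod n = Suc u mod n" using t by (auto simp: V_def)
    obtain t' where t': "t = Suc t'" using t by (cases t) auto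
    have "t' mod n = u" by (rule Suc_mod_cancel) (use u S t' in auto)
    moreover have "s < t'" using ne[OF False] t t' by auto
    ultimately have "next_cut n S s \<le> t'" using u S by (intro next_cut_le) auto
    then show ?thesis using t' by simp
  qed
  have old: "next_cut n V s = next_cut n S s" if s: "s \<in> S - U" for s
  proof (rule next_cut_eqI)
    show "s < next_cut n S s" "next_cut n S s mod n \<in> V" using nS[of s] by (auto simp: V_def)
  next
    fix t assume t: "s < t" "t mod n \<in> V"
    have "t \<noteq> Suc s" if tS: "t mod n \<notin> S"
    proof
      assume "t = Suc s"
      then obtain u where u: "u \<in> U" "Suc s mod n = Suc u mod n" using t tS by (auto simp: V_def)
      have "s mod n = u" by (rule Suc_mod_cancel) (use u S in auto)
      then show False using s u S by auto
    qed
    then show "next_cut n S s \<le> t" using pred_cut t by blast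
  qed
  have new: "next_cut n V (Suc s) = next_cut n S s" if s: "Suc s mod n \<notin> S" for s
  proof (rule next_cut_eqI)
    have "next_cut n S s \<noteq> Suc s" using nS(2)[of s] s by metis
    then show "Suc s < next_cut n S s" using nS(1)[of s] by simp
    show "next_cut n S s mod n \<in> V" using nS[of s] by (auto simp: V_def)
  next
    fix t assume "Suc s < t" "t mod n \<in> V"
    then show "next_cut n S s \<le> t" by (intro pred_cut) auto
  qed
  have unit: "next_cut n S s = Suc s" if "Suc s mod n \<in> S" for s
    by (rule next_cut_eqI) (use that in auto)
  define U1 where "U1 = {s\<in>U. Suc s mod n \<notin> S}"
  have wrap: "G (Suc s) (next_cut n V (Suc s)) = G (Suc s mod n) (next_cut n V (Suc s mod n))"
    if "s < n" for s
  proof (cases "Suc s = n")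
    case True
    then show ?thesis using Gn[of 0 "next_cut n V 0"] next_cut_shift[OF Vn Vne, of 0] by simp
  qed (use that in simp)
  have bij: "bij_betw (\<lambda>s. Suc s mod n) U1 (V - S)"
    unfolding bij_betw_def
  proof
    show "inj_on (\<lambda>s. Suc s mod n) U1"
    proof (rule inj_onI)
      fix a b assume ab: "a \<in> U1" "b \<in> U1" "Suc a mod n = Suc b mod n"
      then have "a < n" "b < n" using S by (auto simp: U1_def)
      then show "a = b" using Suc_mod_cancel[OF ab(3)] by simp
    qed
    show "(\<lambda>s. Suc s mod n) ` U1 = V - S" by (auto simp: U1_def V_def)
  qed
  have "(\<Prod>s\<in>U. G (Suc s) (next_cut n S s)) = (\<Prod>s\<in>U1. G (Suc s) (next_cut n S s))"
    by (rule prod.mono_neutral_right) (auto simp: U1_def unit G1)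
  also have "\<dots> = (\<Prod>s\<in>U1. G (Suc s mod n) (next_cut n V (Suc s mod n)))"
  proof (rule prod.cong)
    fix s assume s: "s \<in> U1"
    then have "s < n" using S by (auto simp: U1_def)
    then show "G (Suc s) (next_cut n S s) = G (Suc s mod n) (next_cut n V (Suc s mod n))"
      using new[of s] wrap[of s] s by (simp add: U1_def)
  qed simp
  also have "\<dots> = (\<Prod>v\<in>V - S. G v (next_cut n V v))"
    by (rule prod.reindex_bij_betw[OF bij])
  finally have 1: "(\<Prod>s\<in>U. G (Suc s) (next_cut n S s)) = (\<Prod>v\<in>V - S. G v (next_cut n V v))" .
  have 2: "(\<Prod>s\<in>S - U. G s (next_cut n S s)) = (\<Prod>s\<in>S - U. G s (next_cut n V s))"
    by (rule prod.cong) (auto simp: old)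
  have "V - U = (V - S) \<union> (S - U)" using S by (auto simp: V_def)
  moreover have "finite V" unfolding V_def by simp
  ultimately have "(\<Prod>v\<in>V - U. G v (next_cut n V v)) =
      (\<Prod>v\<in>V - S. G v (next_cut n V v)) * (\<Prod>v\<in>S - U. G v (next_cut n V v))"
    by (simp add: prod.union_disjoint Int_Diff Diff_Int_distrib2 disjoint_iff)
  then show ?thesis using 1 2 by simp
qed

text \<open>The sign-reversing involution: for a proper \<open>U\<close>, toggling in \<open>S\<close> a point that follows a unit
  step without starting one.\<close>

lemma tilings_with_steps_cancel:
  fixes G :: "nat \<Rightarrow> nat \<Rightarrow> real"
  assumes U: "U \<subseteq> {0..<n}" "U \<noteq> {}"
    and G1: "\<And>a. G a a = 1" and Gn: "\<And>a b. G (a + n) (b + n) = G a b"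
  shows "(\<Sum>S | U \<subseteq> S \<and> S \<subseteq> {0..<n}.
            (\<Prod>s\<in>U. G (Suc s) (next_cut n S s)) * (\<Prod>s\<in>S - U. - G s (next_cut n S s)))
         = (if U = {0..<n} then 1 else 0)"
proof -
  define h where "h V = (\<Prod>v\<in>V - U. G v (next_cut n V v))" for V
  let ?U' = "(\<lambda>u. Suc u mod n) ` U"
  let ?A = "{S. U \<subseteq> S \<and> S \<subseteq> {0..<n}}"
  let ?f = "\<lambda>S. (-1::real) ^ card (S - U) * h (S \<union> ?U')"
  have term_eq: "(\<Prod>s\<in>U. G (Suc s) (next_cut n S s)) * (\<Prod>s\<in>S - U. - G s (next_cut n S s)) = ?f S"
    if "S \<in> ?A" for S
    using arc_weights_refine[of S n U G] that U G1 Gn by (simp add: prod_uminus h_def)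
  have "(\<Sum>S\<in>?A. ?f S) = (if U = {0..<n} then 1 else 0)"
  proof (cases "U = {0..<n}")
    case True
    then have "?A = {U}" by auto
    moreover have "U \<union> ?U' = U" using True U by force
    ultimately show ?thesis using True by (simp add: h_def)
  next
    case False
    then obtain u where u: "u \<in> U" "Suc u mod n \<notin> U"
      using Suc_mod_closed_imp_full[OF U] by blast
    define w where "w = Suc u mod n"
    have w: "w \<in> ?U'" "w \<notin> U" "w < n" using u U by (auto simp: w_def)
    define tog where "tog S = (if w \<in> S then S - {w} else insert w S)" for S
    have flip: "?f (tog S) = - ?f S" if "S \<in> ?A" for S
    proof -
      have fin: "finite (S - U)" using that finite_subset by blast
      have V: "tog S \<union> ?U' = S \<union> ?U'" using w(1) by (auto simp: tog_def)
      have "(-1::real) ^ card (tog S - U) = - ((-1) ^ card (S - U))"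
      proof (cases "w \<in> S")
        case True
        then have "S - U = insert w (tog S - U)" "w \<notin> tog S - U" using w by (auto simp: tog_def)
        then show ?thesis using fin by (metis card_insert_disjoint finite_insert power_Suc
              mult_minus1 minus_minus)
      next
        case False
        then have "tog S - U = insert w (S - U)" "w \<notin> S - U" using w by (auto simp: tog_def)
        then show ?thesis using fin by simp
      qed
      then show ?thesis by (simp only: V mult_minus_left)
    qed
    have "bij_betw tog ?A ?A"
      by (rule bij_betw_byWitness[where f' = tog]) (use w in \<open>auto simp: tog_def split: if_splits\<close>)
    then have "(\<Sum>S\<in>?A. ?f S) = (\<Sum>S\<in>?A. ?f (tog S))"
      using sum.reindex_bij_betw[of tog ?A ?A ?f] by simp
    also have "\<dots> = - (\<Sum>S\<in>?A. ?f S)"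
      unfolding sum_negf[symmetric] by (rule sum.cong[OF refl flip])
    finally show ?thesis using False by simp
  qed
  moreover have "(\<Sum>S\<in>?A. (\<Prod>s\<in>U. G (Suc s) (next_cut n S s)) *
      (\<Prod>s\<in>S - U. - G s (next_cut n S s))) = (\<Sum>S\<in>?A. ?f S)"
    by (rule sum.cong[OF refl term_eq])
  ultimately show ?thesis by simp
qed

lemma cyclic_product_expansion:
  fixes G :: "nat \<Rightarrow> nat \<Rightarrow> real" and y :: "nat \<Rightarrow> real"
  assumes n: "n \<ge> 1"
    and G1: "\<And>a. G a a = 1" and Gn: "\<And>a b. G (a + n) (b + n) = G a b"
  shows "(\<Sum>S | S \<subseteq> {0..<n} \<and> S \<noteq> {}.
            (\<Prod>s\<in>S. y s * G (Suc s) (next_cut n S s) - G s (next_cut n S s))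
            - (\<Prod>s\<in>S. - G s (next_cut n S s))) = (\<Prod>i<n. y i)"
proof -
  let ?A = "{S. S \<subseteq> {0..<n} \<and> S \<noteq> {}}"
  let ?t = "\<lambda>S U. (\<Prod>s\<in>U. y s) *
    ((\<Prod>s\<in>U. G (Suc s) (next_cut n S s)) * (\<Prod>s\<in>S - U. - G s (next_cut n S s)))"
  have finA: "finite ?A" by (rule finite_subset[of _ "Pow {0..<n}"]) auto
  have expand: "(\<Prod>s\<in>S. y s * G (Suc s) (next_cut n S s) - G s (next_cut n S s))
            - (\<Prod>s\<in>S. - G s (next_cut n S s)) = (\<Sum>U | U \<in> ?A \<and> U \<subseteq> S. ?t S U)"
    if S: "S \<in> ?A" for S
  proof -
    have fin: "finite S" using S finite_subset by blast
    have "(\<Prod>s\<in>S. y s * G (Suc s) (next_cut n S s) - G s (next_cut n S s))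
        = (\<Prod>s\<in>S. y s * G (Suc s) (next_cut n S s) + - G s (next_cut n S s))" by simp
    also have "\<dots> = (\<Sum>U\<in>Pow S. ?t S U)"
      by (subst prod_add[OF fin]) (simp add: prod.distrib mult.assoc)
    also have "\<dots> = ?t S {} + (\<Sum>U\<in>Pow S - {{}}. ?t S U)"
      using fin by (intro sum.remove) auto
    also have "Pow S - {{}} = {U. U \<in> ?A \<and> U \<subseteq> S}" using S by auto
    finally show ?thesis by simp
  qed
  have "(\<Sum>S\<in>?A. (\<Prod>s\<in>S. y s * G (Suc s) (next_cut n S s) - G s (next_cut n S s))
            - (\<Prod>s\<in>S. - G s (next_cut n S s)))
      = (\<Sum>S\<in>?A. \<Sum>U | U \<in> ?A \<and> U \<subseteq> S. ?t S U)"
    by (rule sum.cong[OF refl expand])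
  also have "\<dots> = (\<Sum>U\<in>?A. \<Sum>S | S \<in> ?A \<and> U \<subseteq> S. ?t S U)"
    by (rule sum.swap_restrict[OF finA finA])
  also have "\<dots> = (\<Sum>U\<in>?A. (\<Prod>s\<in>U. y s) * (if U = {0..<n} then 1 else 0))"
  proof (rule sum.cong)
    fix U assume U: "U \<in> ?A"
    then have "{S. S \<in> ?A \<and> U \<subseteq> S} = {S. U \<subseteq> S \<and> S \<subseteq> {0..<n}}" by auto
    then show "(\<Sum>S | S \<in> ?A \<and> U \<subseteq> S. ?t S U) = (\<Prod>s\<in>U. y s) * (if U = {0..<n} then 1 else 0)"
      using tilings_with_steps_cancel[of U n G] U G1 Gn by (simp add: sum_distrib_left[symmetric])
  qed simp
  also have "\<dots> = (\<Sum>U\<in>?A. if U = {0..<n} then \<Prod>s\<in>{0..<n}. y s else 0)"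
    by (rule sum.cong) auto
  also have "\<dots> = (\<Prod>i<n. y i)"
    using finA n by (simp add: sum.delta lessThan_atLeast0)
  finally show ?thesis .
qed

section \<open>Nested floors\<close>

lemma nested_floor_shift: "nested_floor n x (a + n) (b + n) = nested_floor n x a b"
proof (induction n x a b rule: nested_floor.induct)
  case (1 n x a b)
  then show ?case
    by (subst (1 2) nested_floor.simps) (simp del: One_nat_def)
qed

lemma prod_cyclic_list:
  assumes S: "S \<subseteq> {0..<n}" "S \<noteq> {}"
  shows "(\<Prod>i<card S. g (cyclic_list n S ! i) (cyclic_list n S ! Suc i))
       = (\<Prod>s\<in>S. g s (next_cut n S s))"
proof -
  define xs where "xs = sorted_list_of_set S"
  have fin: "finite S" using S finite_subset by blast
  have xs: "set xs = S" "length xs = card S" "sorted_wrt (<) xs" "distinct xs"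
    using fin by (auto simp: xs_def)
  have nxt: "next_cut n S (xs ! i) = cyclic_list n S ! Suc i" if i: "i < card S" for i
  proof (cases "Suc i < card S")
    case True
    then have eq: "cyclic_list n S ! Suc i = xs ! Suc i"
      using xs by (simp add: cyclic_list_def xs_def nth_append)
    have mem: "xs ! Suc i \<in> S" using True xs by (metis nth_mem)
    show ?thesis unfolding eq
    proof (rule next_cut_eqI)
      show "xs ! i < xs ! Suc i" using xs True by (auto simp: sorted_wrt_iff_nth_less)
      show "xs ! Suc i mod n \<in> S" using mem S by auto
    next
      fix t assume t: "xs ! i < t" "t mod n \<in> S"
      show "xs ! Suc i \<le> t"
      proof (cases "t < n")
        case True
        then obtain j where j: "j < card S" "t = xs ! j" using t xs by (metis in_set_conv_nth mod_less)
        have "\<not> j \<le> i" using t(1) j i xs by (metis leD le_neq_implies_less less_or_eq_imp_le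
              sorted_wrt_iff_nth_less)
        then have "Suc i = j \<or> Suc i < j" by auto
        then show ?thesis using j xs by (auto simp: sorted_wrt_iff_nth_less intro: less_imp_le)
      qed (use mem S in force)
    qed
  next
    case False
    then have k: "Suc i = card S" using i by simp
    then have eq: "cyclic_list n S ! Suc i = Min S + n"
      using xs by (simp add: cyclic_list_def xs_def nth_append)
    have mem: "Min S \<in> S" "xs ! i \<in> S" using S fin i xs by auto
    show ?thesis unfolding eq
    proof (rule next_cut_eqI)
      show "xs ! i < Min S + n" "(Min S + n) mod n \<in> S" using mem S by auto
    next
      fix t assume t: "xs ! i < t" "t mod n \<in> S"
      have "n \<le> t"
      proof (rule ccontr)
        assume "\<not> n \<le> t"
        then obtain j where j: "j < card S" "t = xs ! j" using t xs
          by (metis in_set_conv_nth mod_less not_le)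
        then have "j < i \<or> j = i" using k by auto
        then show False using t j i xs by (auto simp: sorted_wrt_iff_nth_less dest: less_asym)
      qed
      moreover have "Min S \<le> t mod n" using t fin by simp
      moreover have "t mod n \<le> t - n" if "n \<le> t" using that by (simp add: le_mod_geq)
      ultimately show "Min S + n \<le> t" by linarith
    qed
  qed
  have "(\<Prod>i<card S. g (cyclic_list n S ! i) (cyclic_list n S ! Suc i))
      = (\<Prod>i<card S. g (xs ! i) (next_cut n S (xs ! i)))"
    using xs(2) by (intro prod.cong) (auto simp: nxt, simp add: cyclic_list_def xs_def nth_append)
  also have "\<dots> = (\<Prod>s\<in>S. g s (next_cut n S s))"
    by (rule prod.reindex_bij_betw, rule bij_betw_nth) (use xs in auto)
  finally show ?thesis .
qed

theorem mainTheorem1: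
  fixes n :: nat and x :: "nat \<Rightarrow> real"
  assumes "n \<ge> 1"
  shows "(\<Prod>i<n. x i) =
    (\<Sum>S | S \<subseteq> {0..<n} \<and> S \<noteq> {}.
       (\<Prod>i<card S. frac (nested_floor n x (cyclic_list n S ! i) (cyclic_list n S ! Suc i)))
       - (-1) ^ card S *
         (\<Prod>i<card S. real_of_int
            \<lfloor>nested_floor n x (cyclic_list n S ! i) (cyclic_list n S ! Suc i)\<rfloor>))"
proof -
  define G where "G a b = real_of_int \<lfloor>nested_floor n x a b\<rfloor>" for a b
  have G1: "G a a = 1" for a by (simp add: G_def nested_floor.simps)
  have Gn: "G (a + n) (b + n) = G a b" for a b by (simp add: G_def nested_floor_shift)
  have frac_eq: "frac (nested_floor n x s (next_cut n S s))
      = x s * G (Suc s) (next_cut n S s) - G s (next_cut n S s)"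
    if "S \<subseteq> {0..<n}" "s \<in> S" for S s
  proof -
    have "s < next_cut n S s" "s mod n = s" using next_cut_props(1)[OF that(1)] that by auto
    then have "nested_floor n x s (next_cut n S s) = x s * G (Suc s) (next_cut n S s)"
      by (subst nested_floor.simps) (simp add: G_def)
    then show ?thesis by (simp add: frac_def G_def)
  qed
  have "(\<Prod>i<n. x i) = (\<Sum>S | S \<subseteq> {0..<n} \<and> S \<noteq> {}.
            (\<Prod>s\<in>S. x s * G (Suc s) (next_cut n S s) - G s (next_cut n S s))
            - (\<Prod>s\<in>S. - G s (next_cut n S s)))"
    using cyclic_product_expansion[of n G x, OF assms G1 Gn] by simp
  also have "\<dots> = (\<Sum>S | S \<subseteq> {0..<n} \<and> S \<noteq> {}.
       (\<Prod>i<card S. frac (nested_floor n x (cyclic_list n S ! i) (cyclic_list n S ! Suc i)))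
       - (-1) ^ card S *
         (\<Prod>i<card S. real_of_int
            \<lfloor>nested_floor n x (cyclic_list n S ! i) (cyclic_list n S ! Suc i)\<rfloor>))"
  proof (rule sum.cong)
    fix S assume "S \<in> {S. S \<subseteq> {0..<n} \<and> S \<noteq> {}}"
    then have S: "S \<subseteq> {0..<n}" "S \<noteq> {}" by auto
    show "(\<Prod>s\<in>S. x s * G (Suc s) (next_cut n S s) - G s (next_cut n S s))
            - (\<Prod>s\<in>S. - G s (next_cut n S s)) =
       (\<Prod>i<card S. frac (nested_floor n x (cyclic_list n S ! i) (cyclic_list n S ! Suc i)))
       - (-1) ^ card S *
         (\<Prod>i<card S. real_of_int
            \<lfloor>nested_floor n x (cyclic_list n S ! i) (cyclic_list n S ! Suc i)\<rfloor>)"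
      using prod_cyclic_list[OF S, of "\<lambda>a b. frac (nested_floor n x a b)"]
        prod_cyclic_list[OF S, of G] frac_eq[OF S(1)]
      by (simp add: prod_uminus G_def cong: prod.cong)
  qed simp
  finally show ?thesis .
qed

end
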